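(* Let $G$ and $H$ be two non-trivial groups. Let $C$ be a left-relatively convex subgroup on the free product $G*H$ having finite Kurosh rank with respect to $G*H$. Let $\preceq$ be a left-preorder on $G*H$ relative to $C$. Then the positive cone of $\preceq$ is not finitely generated as a subsemigroup of $G*H$.
   Context: A left-preorder on a group $\Gamma$ is a total, transitive, reflexive binary relation $\preceq$ on $\Gamma$ that is left-invariant ($g_1\preceq g_2$ implies $gg_1\preceq gg_2$) and non-trivial (not all pairs are related). For a left-preorder $\preceq$, the set $C=\{g: g\preceq 1 \text{ and } 1\preceq g\}$ is a proper subgroup of $\Gamma$, and $\preceq$ is said to be a left-preorder on $\Gamma$ relative to $C$; its positive cone is $P=\{g\in\Gamma: 1\preceq g,\ g\notin C\}$, which is a subsemigroup with $\Gamma=P\sqcup P^{-1}\sqcup C$. A proper subgroup $C$ of $\Gamma$ is left-relatively convex on $\Gamma$ if there exists a left-preorder on $\Gamma$ relative to $C$. Kurosh rank: by Kurosh's theorem, a subgroup $C$ of $G*H$ decomposes as $C=\mathbb{F}*\big(\ast_x\, C\cap xGx^{-1}\big)*\big(\ast_y\, C\cap yHy^{-1}\big)$, where $\mathbb{F}$ is a free subgroup, $x$ ranges over a (suitable) set of representatives of $C\backslash(G*H)/G$ and $y$ over a (suitable) set of representatives of $C\backslash(G*H)/H$. The Kurosh rank of $C$ with respect to $G*H$ is the free rank of $\mathbb{F}$ plus the number of non-trivial factors $C\cap xGx^{-1}$ and $C\cap yHy^{-1}$; it does not depend on the chosen decomposition. *)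

theory Defs
  imports "HOL-Algebra.Coset" "HOL-Library.Extended_Nat"
begin

section \<open>Free products of two groups\<close>

text \<open>
  The free product is built on normal forms: finite sequences of non-trivial elements of the two
  groups (tagged by \<^const>\<open>Inl\<close> and \<^const>\<open>Inr\<close>), taken alternately from one and the other.
\<close>

definition fp_letters :: "('a, 'c) monoid_scheme \<Rightarrow> ('b, 'd) monoid_scheme \<Rightarrow> ('a + 'b) set" where
  "fp_letters G H = Inl ` (carrier G - {\<one>\<^bsub>G\<^esub>}) \<union> Inr ` (carrier H - {\<one>\<^bsub>H\<^esub>})"

definition fp_words :: "('a, 'c) monoid_scheme \<Rightarrow> ('b, 'd) monoid_scheme \<Rightarrow> ('a + 'b) list set" where
  "fp_words G H = {w. set w \<subseteq> fp_letters G H \<and> distinct_adj (map isl w)}"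

text \<open>Left multiplication of a normal form by one element of one of the factors.\<close>

fun fp_cons ::
  "('a, 'c) monoid_scheme \<Rightarrow> ('b, 'd) monoid_scheme \<Rightarrow> 'a + 'b \<Rightarrow> ('a + 'b) list \<Rightarrow> ('a + 'b) list" where
  "fp_cons G H (Inl g) (Inl g' # w) =
     (if g \<otimes>\<^bsub>G\<^esub> g' = \<one>\<^bsub>G\<^esub> then w else Inl (g \<otimes>\<^bsub>G\<^esub> g') # w)"
| "fp_cons G H (Inr h) (Inr h' # w) =
     (if h \<otimes>\<^bsub>H\<^esub> h' = \<one>\<^bsub>H\<^esub> then w else Inr (h \<otimes>\<^bsub>H\<^esub> h') # w)"
| "fp_cons G H (Inl g) w = (if g = \<one>\<^bsub>G\<^esub> then w else Inl g # w)"
| "fp_cons G H (Inr h) w = (if h = \<one>\<^bsub>H\<^esub> then w else Inr h # w)"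

definition free_product ::
  "('a, 'c) monoid_scheme \<Rightarrow> ('b, 'd) monoid_scheme \<Rightarrow> ('a + 'b) list monoid" where
  "free_product G H = \<lparr>carrier = fp_words G H, mult = foldr (fp_cons G H), one = []\<rparr>"

definition fp_inl :: "('a, 'c) monoid_scheme \<Rightarrow> ('b, 'd) monoid_scheme \<Rightarrow> 'a \<Rightarrow> ('a + 'b) list" where
  "fp_inl G H g = fp_cons G H (Inl g) []"

definition fp_inr :: "('a, 'c) monoid_scheme \<Rightarrow> ('b, 'd) monoid_scheme \<Rightarrow> 'b \<Rightarrow> ('a + 'b) list" where
  "fp_inr G H h = fp_cons G H (Inr h) []"


section \<open>Internal free products and free subgroups\<close>

definition word_prod :: "('g, 'm) monoid_scheme \<Rightarrow> 'g list \<Rightarrow> 'g" where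
  "word_prod \<Gamma> w = foldr (\<otimes>\<^bsub>\<Gamma>\<^esub>) w \<one>\<^bsub>\<Gamma>\<^esub>"

definition alternating_words ::
  "('g, 'm) monoid_scheme \<Rightarrow> 'i set \<Rightarrow> ('i \<Rightarrow> 'g set) \<Rightarrow> ('i \<times> 'g) list set" where
  "alternating_words \<Gamma> I K =
     {w. (\<forall>(i, g) \<in> set w. i \<in> I \<and> g \<in> K i - {\<one>\<^bsub>\<Gamma>\<^esub>}) \<and> distinct_adj (map fst w)}"

text \<open>
  A subgroup is the free product of a family of subgroups if each of its elements is uniquely the
  product of an alternating word in the family. Trivial members of the family play no role.
\<close>

definition internal_free_product ::
  "('g, 'm) monoid_scheme \<Rightarrow> 'g set \<Rightarrow> 'i set \<Rightarrow> ('i \<Rightarrow> 'g set) \<Rightarrow> bool" where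
  "internal_free_product \<Gamma> C I K \<longleftrightarrow>
     (\<forall>i\<in>I. subgroup (K i) \<Gamma>) \<and>
     bij_betw (\<lambda>w. word_prod \<Gamma> (map snd w)) (alternating_words \<Gamma> I K) C"

text \<open>In a free word, \<open>(True, b)\<close> stands for \<open>b\<close> and \<open>(False, b)\<close> for its inverse.\<close>

definition free_words :: "'g set \<Rightarrow> (bool \<times> 'g) list set" where
  "free_words B =
     {w. snd ` set w \<subseteq> B \<and>
         successively (\<lambda>(e, b) (e', b'). \<not> (b = b' \<and> e \<noteq> e')) w}"

definition free_word_value :: "('g, 'm) monoid_scheme \<Rightarrow> (bool \<times> 'g) list \<Rightarrow> 'g" where
  "free_word_value \<Gamma> w =
     word_prod \<Gamma> (map (\<lambda>(e, b). if e then b else inv\<^bsub>\<Gamma>\<^esub> b) w)"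

definition free_on :: "('g, 'm) monoid_scheme \<Rightarrow> 'g set \<Rightarrow> 'g set \<Rightarrow> bool" where
  "free_on \<Gamma> B F \<longleftrightarrow>
     B \<subseteq> carrier \<Gamma> \<and> subgroup F \<Gamma> \<and> bij_betw (free_word_value \<Gamma>) (free_words B) F"


section \<open>Kurosh rank\<close>

definition conj_subgroup :: "('g, 'm) monoid_scheme \<Rightarrow> 'g \<Rightarrow> 'g set \<Rightarrow> 'g set" where
  "conj_subgroup \<Gamma> x K = (x <#\<^bsub>\<Gamma>\<^esub> K) #>\<^bsub>\<Gamma>\<^esub> inv\<^bsub>\<Gamma>\<^esub> x"

text \<open>\<open>X\<close> contains exactly one element of each double coset in \<open>C \ \<Gamma> / K\<close>.\<close>

definition double_coset_reps ::
  "('g, 'm) monoid_scheme \<Rightarrow> 'g set \<Rightarrow> 'g set \<Rightarrow> 'g set \<Rightarrow> bool" where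
  "double_coset_reps \<Gamma> C K X \<longleftrightarrow>
     X \<subseteq> carrier \<Gamma> \<and> (\<forall>g \<in> carrier \<Gamma>. \<exists>!x. x \<in> X \<and> g \<in> (C #>\<^bsub>\<Gamma>\<^esub> x) <#>\<^bsub>\<Gamma>\<^esub> K)"

datatype 'g kurosh_index = FreePart | LeftPart 'g | RightPart 'g

fun kurosh_factor ::
  "('a, 'c) monoid_scheme \<Rightarrow> ('b, 'd) monoid_scheme \<Rightarrow> ('a + 'b) list set \<Rightarrow> ('a + 'b) list set
     \<Rightarrow> ('a + 'b) list kurosh_index \<Rightarrow> ('a + 'b) list set" where
  "kurosh_factor G H C F FreePart = F"
| "kurosh_factor G H C F (LeftPart x) =
     C \<inter> conj_subgroup (free_product G H) x (fp_inl G H ` carrier G)"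
| "kurosh_factor G H C F (RightPart y) =
     C \<inter> conj_subgroup (free_product G H) y (fp_inr G H ` carrier H)"

text \<open>
  \<open>B\<close> is a basis of the free part \<open>F\<close>; \<open>X\<close> and \<open>Y\<close> are the sets of double coset representatives.
\<close>

definition kurosh_decomposition ::
  "('a, 'c) monoid_scheme \<Rightarrow> ('b, 'd) monoid_scheme \<Rightarrow> ('a + 'b) list set
     \<Rightarrow> ('a + 'b) list set \<Rightarrow> ('a + 'b) list set \<Rightarrow> ('a + 'b) list set \<Rightarrow> ('a + 'b) list set \<Rightarrow> bool"
  where
  "kurosh_decomposition G H C B F X Y \<longleftrightarrow>
     free_on (free_product G H) B F \<and>
     double_coset_reps (free_product G H) C (fp_inl G H ` carrier G) X \<and>
     double_coset_reps (free_product G H) C (fp_inr G H ` carrier H) Y \<and>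
     internal_free_product (free_product G H) C
       (insert FreePart (LeftPart ` X \<union> RightPart ` Y)) (kurosh_factor G H C F)"

definition ecard :: "'x set \<Rightarrow> enat" where
  "ecard A = (if finite A then enat (card A) else \<infinity>)"

definition kurosh_decomposition_rank ::
  "('a, 'c) monoid_scheme \<Rightarrow> ('b, 'd) monoid_scheme \<Rightarrow> ('a + 'b) list set
     \<Rightarrow> ('a + 'b) list set \<Rightarrow> ('a + 'b) list set \<Rightarrow> ('a + 'b) list set \<Rightarrow> ('a + 'b) list set \<Rightarrow> enat"
  where
  "kurosh_decomposition_rank G H C B F X Y =
     ecard B
     + ecard {x \<in> X. kurosh_factor G H C F (LeftPart x) \<noteq> {\<one>\<^bsub>free_product G H\<^esub>}}
     + ecard {y \<in> Y. kurosh_factor G H C F (RightPart y) \<noteq> {\<one>\<^bsub>free_product G H\<^esub>}}"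

text \<open>
  Every subgroup has a Kurosh decomposition, and all its Kurosh decompositions have the same rank,
  so the infimum is taken over a singleton.
\<close>

definition kurosh_rank ::
  "('a, 'c) monoid_scheme \<Rightarrow> ('b, 'd) monoid_scheme \<Rightarrow> ('a + 'b) list set \<Rightarrow> enat" where
  "kurosh_rank G H C =
     Inf {kurosh_decomposition_rank G H C B F X Y | B F X Y. kurosh_decomposition G H C B F X Y}"


section \<open>Left-preorders\<close>

text \<open>\<open>(g, h) \<in> R\<close> stands for \<open>g \<preceq> h\<close>.\<close>

definition left_preorder :: "('g, 'm) monoid_scheme \<Rightarrow> ('g \<times> 'g) set \<Rightarrow> bool" where
  "left_preorder \<Gamma> R \<longleftrightarrow>
     preorder_on (carrier \<Gamma>) R \<and>
     total_on (carrier \<Gamma>) R \<and>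
     (\<forall>g \<in> carrier \<Gamma>. \<forall>(g1, g2) \<in> R. (g \<otimes>\<^bsub>\<Gamma>\<^esub> g1, g \<otimes>\<^bsub>\<Gamma>\<^esub> g2) \<in> R) \<and>
     R \<noteq> carrier \<Gamma> \<times> carrier \<Gamma>"

definition preorder_residue :: "('g, 'm) monoid_scheme \<Rightarrow> ('g \<times> 'g) set \<Rightarrow> 'g set" where
  "preorder_residue \<Gamma> R = {g \<in> carrier \<Gamma>. (g, \<one>\<^bsub>\<Gamma>\<^esub>) \<in> R \<and> (\<one>\<^bsub>\<Gamma>\<^esub>, g) \<in> R}"

definition left_preorder_relative ::
  "('g, 'm) monoid_scheme \<Rightarrow> 'g set \<Rightarrow> ('g \<times> 'g) set \<Rightarrow> bool" where
  "left_preorder_relative \<Gamma> C R \<longleftrightarrow> left_preorder \<Gamma> R \<and> C = preorder_residue \<Gamma> R"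

definition positive_cone :: "('g, 'm) monoid_scheme \<Rightarrow> ('g \<times> 'g) set \<Rightarrow> 'g set" where
  "positive_cone \<Gamma> R = {g \<in> carrier \<Gamma>. (\<one>\<^bsub>\<Gamma>\<^esub>, g) \<in> R \<and> g \<notin> preorder_residue \<Gamma> R}"

definition left_relatively_convex :: "('g, 'm) monoid_scheme \<Rightarrow> 'g set \<Rightarrow> bool" where
  "left_relatively_convex \<Gamma> C \<longleftrightarrow>
     subgroup C \<Gamma> \<and> C \<noteq> carrier \<Gamma> \<and> (\<exists>R. left_preorder_relative \<Gamma> C R)"


section \<open>Finitely generated subsemigroups\<close>

inductive_set subsemigroup_generated :: "('g, 'm) monoid_scheme \<Rightarrow> 'g set \<Rightarrow> 'g set"
  for \<Gamma> S where
  incl: "s \<in> S \<Longrightarrow> s \<in> subsemigroup_generated \<Gamma> S"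
| mult: "a \<in> subsemigroup_generated \<Gamma> S \<Longrightarrow> b \<in> subsemigroup_generated \<Gamma> S \<Longrightarrow>
         a \<otimes>\<^bsub>\<Gamma>\<^esub> b \<in> subsemigroup_generated \<Gamma> S"

definition finitely_generated_subsemigroup :: "('g, 'm) monoid_scheme \<Rightarrow> 'g set \<Rightarrow> bool" where
  "finitely_generated_subsemigroup \<Gamma> P \<longleftrightarrow>
     (\<exists>S. finite S \<and> S \<subseteq> carrier \<Gamma> \<and> P = subsemigroup_generated \<Gamma> S)"


section \<open>Basic facts\<close>

lemma fp_words_Nil [simp]: "[] \<in> fp_words G H"
  by (simp add: fp_words_def)

lemma fp_words_Cons:
  "x # w \<in> fp_words G H \<longleftrightarrow>
     x \<in> fp_letters G H \<and> w \<in> fp_words G H \<and> (w \<noteq> [] \<longrightarrow> isl (hd w) \<noteq> isl x)"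
  by (cases w) (auto simp: fp_words_def)

lemma fp_letters_iff [simp]:
  "Inl g \<in> fp_letters G H \<longleftrightarrow> g \<in> carrier G \<and> g \<noteq> \<one>\<^bsub>G\<^esub>"
  "Inr h \<in> fp_letters G H \<longleftrightarrow> h \<in> carrier H \<and> h \<noteq> \<one>\<^bsub>H\<^esub>"
  by (auto simp: fp_letters_def)

lemma free_product_simps [simp]:
  "carrier (free_product G H) = fp_words G H"
  "u \<otimes>\<^bsub>free_product G H\<^esub> v = foldr (fp_cons G H) u v"
  "\<one>\<^bsub>free_product G H\<^esub> = []"
  by (simp_all add: free_product_def)

locale two_groups = G: group G + H: group H for G (structure) and H (structure)
begin

abbreviation "syl \<equiv> Inl ` carrier G \<union> Inr ` carrier H"

lemma letters_syl: "fp_letters G H \<subseteq> syl"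
  by (auto simp: fp_letters_def)

lemma set_fp_words: "w \<in> fp_words G H \<Longrightarrow> set w \<subseteq> syl"
  using letters_syl by (auto simp: fp_words_def)

lemma fp_cons_closed:
  assumes "x \<in> syl" "w \<in> fp_words G H"
  shows "fp_cons G H x w \<in> fp_words G H"
proof (cases w)
  case Nil
  then show ?thesis using assms by (auto simp: fp_words_Cons)
next
  case (Cons y v)
  then show ?thesis using assms
    by (cases y) (auto simp: fp_words_Cons split: if_splits)
qed

lemma foldr_closed:
  "set u \<subseteq> syl \<Longrightarrow> w \<in> fp_words G H \<Longrightarrow> foldr (fp_cons G H) u w \<in> fp_words G H"
  by (induction u) (use fp_cons_closed in \<open>auto\<close>)

lemma fp_cons_reduced:
  "x # w \<in> fp_words G H \<Longrightarrow> fp_cons G H x w = x # w"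
  by (cases x; cases w; cases "hd w") (auto simp: fp_words_Cons)

lemma foldr_Nil: "w \<in> fp_words G H \<Longrightarrow> foldr (fp_cons G H) w [] = w"
proof (induction w)
  case (Cons x w)
  then show ?case using fp_cons_reduced[of x w] by (simp add: fp_words_Cons)
qed simp

lemma fp_cons_Inl_Inl:
  assumes "a \<in> carrier G" "b \<in> carrier G" "w \<in> fp_words G H"
  shows "fp_cons G H (Inl a) (fp_cons G H (Inl b) w) = fp_cons G H (Inl (a \<otimes>\<^bsub>G\<^esub> b)) w"
proof (cases "\<exists>c v. w = Inl c # v")
  case True
  then obtain c v where w: "w = Inl c # v" by blast
  have c: "c \<in> carrier G" "c \<noteq> \<one>\<^bsub>G\<^esub>" and v: "v = [] \<or> (\<exists>h v'. v = Inr h # v')"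
    using assms(3) w by (cases v; cases "hd v"; auto simp: fp_words_Cons)+
  have "a \<otimes>\<^bsub>G\<^esub> b \<otimes>\<^bsub>G\<^esub> c = a" if "b \<otimes>\<^bsub>G\<^esub> c = \<one>\<^bsub>G\<^esub>"
    using that assms c by (simp add: G.m_assoc)
  then show ?thesis using assms c v w by (auto simp: G.m_assoc)
next
  case False
  then have "w = [] \<or> (\<exists>h v. w = Inr h # v)" by (cases w; cases "hd w") auto
  then show ?thesis using assms by auto
qed

lemma fp_cons_Inr_Inr:
  assumes "a \<in> carrier H" "b \<in> carrier H" "w \<in> fp_words G H"
  shows "fp_cons G H (Inr a) (fp_cons G H (Inr b) w) = fp_cons G H (Inr (a \<otimes>\<^bsub>H\<^esub> b)) w"
proof (cases "\<exists>c v. w = Inr c # v")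
  case True
  then obtain c v where w: "w = Inr c # v" by blast
  have c: "c \<in> carrier H" "c \<noteq> \<one>\<^bsub>H\<^esub>" and v: "v = [] \<or> (\<exists>g v'. v = Inl g # v')"
    using assms(3) w by (cases v; cases "hd v"; auto simp: fp_words_Cons)+
  have "a \<otimes>\<^bsub>H\<^esub> b \<otimes>\<^bsub>H\<^esub> c = a" if "b \<otimes>\<^bsub>H\<^esub> c = \<one>\<^bsub>H\<^esub>"
    using that assms c by (simp add: H.m_assoc)
  then show ?thesis using assms c v w by (auto simp: H.m_assoc)
next
  case False
  then have "w = [] \<or> (\<exists>g v. w = Inl g # v)" by (cases w; cases "hd w") auto
  then show ?thesis using assms by auto
qed

lemma fp_cons_one:
  "w \<in> fp_words G H \<Longrightarrow> fp_cons G H (Inl \<one>\<^bsub>G\<^esub>) w = w"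
  "w \<in> fp_words G H \<Longrightarrow> fp_cons G H (Inr \<one>\<^bsub>H\<^esub>) w = w"
  by (cases w; cases "hd w"; auto simp: fp_words_Cons)+

lemma foldr_fp_cons:
  assumes "x \<in> syl" "v \<in> fp_words G H" "w \<in> fp_words G H"
  shows "foldr (fp_cons G H) (fp_cons G H x v) w = fp_cons G H x (foldr (fp_cons G H) v w)"
proof (cases "x # v \<in> fp_words G H")
  case True
  then show ?thesis by (simp add: fp_cons_reduced)
next
  case False
  have cl: "foldr (fp_cons G H) v' w \<in> fp_words G H" if "v' \<in> fp_words G H" for v'
    using that assms set_fp_words foldr_closed by blast
  consider (L) g where "x = Inl g" "g \<in> carrier G" | (R) h where "x = Inr h" "h \<in> carrier H"
    using assms by blast
  then show ?thesis
  proof cases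
    case L
    show ?thesis
    proof (cases "g = \<one>\<^bsub>G\<^esub>")
      case True
      then show ?thesis using L assms cl fp_cons_one by simp
    next
      case g: False
      then obtain c v' where v: "v = Inl c # v'"
        using False L assms(2) by (cases v; cases "hd v") (auto simp: fp_words_Cons)
      then have c: "c \<in> carrier G" "v' \<in> fp_words G H"
        using assms(2) by (auto simp: fp_words_Cons)
      show ?thesis
        using L v c cl fp_cons_Inl_Inl[of g c "foldr (fp_cons G H) v' w"] fp_cons_one by auto
    qed
  next
    case R
    show ?thesis
    proof (cases "h = \<one>\<^bsub>H\<^esub>")
      case True
      then show ?thesis using R assms cl fp_cons_one by simp
    next
      case h: False
      then obtain c v' where v: "v = Inr c # v'"
        using False R assms(2) by (cases v; cases "hd v") (auto simp: fp_words_Cons)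
      then have c: "c \<in> carrier H" "v' \<in> fp_words G H"
        using assms(2) by (auto simp: fp_words_Cons)
      show ?thesis
        using R v c cl fp_cons_Inr_Inr[of h c "foldr (fp_cons G H) v' w"] fp_cons_one by auto
    qed
  qed
qed

lemma foldr_assoc:
  assumes "set u \<subseteq> syl" "v \<in> fp_words G H" "w \<in> fp_words G H"
  shows "foldr (fp_cons G H) (foldr (fp_cons G H) u v) w =
         foldr (fp_cons G H) u (foldr (fp_cons G H) v w)"
  using assms by (induction u) (auto simp: foldr_fp_cons foldr_closed)

lemma left_inverse:
  assumes "u \<in> fp_words G H"
  shows "\<exists>v \<in> fp_words G H. foldr (fp_cons G H) v u = []"
  using assms
proof (induction u)
  case Nil
  show ?case by (rule bexI[of _ "[]"]) simp_all
next
  case (Cons x u)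
  then obtain v where v: "v \<in> fp_words G H" "foldr (fp_cons G H) v u = []"
    by (auto simp: fp_words_Cons)
  define y where "y = map_sum (\<lambda>g. inv\<^bsub>G\<^esub> g) (\<lambda>h. inv\<^bsub>H\<^esub> h) x"
  have y: "y \<in> syl" "fp_cons G H y (x # u) = u"
    using Cons.prems by (cases x; auto simp: y_def fp_words_Cons)+
  have y': "fp_cons G H y [] \<in> fp_words G H" using y fp_cons_closed by simp
  have "foldr (fp_cons G H) (foldr (fp_cons G H) v (fp_cons G H y [])) (x # u)
      = foldr (fp_cons G H) v (foldr (fp_cons G H) (fp_cons G H y []) (x # u))"
    by (rule foldr_assoc[OF set_fp_words[OF v(1)] y' Cons.prems])
  also have "foldr (fp_cons G H) (fp_cons G H y []) (x # u) = u"
    using foldr_fp_cons[OF y(1) _ Cons.prems, of "[]"] y by simp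
  finally show ?case
    using v foldr_closed[OF set_fp_words[OF v(1)] y'] by auto
qed

lemma group_free_product: "group (free_product G H)"
proof (rule groupI)
  fix u v w
  assume uvw: "u \<in> carrier (free_product G H)" "v \<in> carrier (free_product G H)"
    "w \<in> carrier (free_product G H)"
  show "u \<otimes>\<^bsub>free_product G H\<^esub> v \<otimes>\<^bsub>free_product G H\<^esub> w =
        u \<otimes>\<^bsub>free_product G H\<^esub> (v \<otimes>\<^bsub>free_product G H\<^esub> w)"
    using uvw foldr_assoc set_fp_words by simp
qed (use left_inverse set_fp_words foldr_closed in auto)

lemma fp_inl_hom: "fp_inl G H \<in> hom G (free_product G H)"
  and inj_fp_inl: "inj_on (fp_inl G H) (carrier G)"
  by (auto simp: hom_def fp_inl_def inj_on_def fp_words_Cons)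

lemma fp_inr_hom: "fp_inr G H \<in> hom H (free_product G H)"
  and inj_fp_inr: "inj_on (fp_inr G H) (carrier H)"
  by (auto simp: hom_def fp_inr_def inj_on_def fp_words_Cons)

text \<open>The universal property of the free product.\<close>

lemma free_product_universal_ex:
  assumes "group K" "\<phi> \<in> hom G K" "\<psi> \<in> hom H K"
  shows "\<exists>\<theta> \<in> hom (free_product G H) K.
    (\<forall>g \<in> carrier G. \<theta> (fp_inl G H g) = \<phi> g) \<and> (\<forall>h \<in> carrier H. \<theta> (fp_inr G H h) = \<psi> h)"
proof -
  interpret K: group K by fact
  interpret p: group_hom G K \<phi> by unfold_locales fact
  interpret q: group_hom H K \<psi> by unfold_locales fact
  define f where "f = case_sum \<phi> \<psi>"
  define \<theta> where "\<theta> w = foldr (\<lambda>x k. f x \<otimes>\<^bsub>K\<^esub> k) w \<one>\<^bsub>K\<^esub>" for w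
  have f: "f x \<in> carrier K" if "x \<in> syl" for x using that by (auto simp: f_def)
  have cl: "\<theta> w \<in> carrier K" if "set w \<subseteq> syl" for w
    using that by (induction w) (use f in \<open>auto simp: \<theta>_def\<close>)
  have cons: "\<theta> (fp_cons G H x w) = f x \<otimes>\<^bsub>K\<^esub> \<theta> w" if "x \<in> syl" "w \<in> fp_words G H" for x w
  proof (cases w)
    case Nil
    then show ?thesis using that by (auto simp: \<theta>_def f_def)
  next
    case (Cons y v)
    then have v: "\<theta> v \<in> carrier K" using that(2) cl set_fp_words by (simp add: fp_words_Cons)
    have y: "y \<in> syl" using that(2) Cons letters_syl by (auto simp: fp_words_Cons)
    have \<theta>C: "\<theta> (z # v) = f z \<otimes>\<^bsub>K\<^esub> \<theta> v" for z by (simp add: \<theta>_def)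
    show ?thesis
    proof (cases "isl x = isl y")
      case True
      show ?thesis
      proof (cases x)
        case (Inl a)
        then obtain b where b: "y = Inl b" using True by (cases y) auto
        have ab: "a \<in> carrier G" "b \<in> carrier G" using that Inl b y by auto
        have "\<theta> v = \<phi> a \<otimes>\<^bsub>K\<^esub> (\<phi> b \<otimes>\<^bsub>K\<^esub> \<theta> v)" if "a \<otimes>\<^bsub>G\<^esub> b = \<one>\<^bsub>G\<^esub>"
          using that ab v by (metis K.l_one K.m_assoc p.hom_closed p.hom_mult p.hom_one)
        then show ?thesis using Inl b ab Cons v by (simp add: \<theta>C f_def K.m_assoc)
      next
        case (Inr a)
        then obtain b where b: "y = Inr b" using True by (cases y) auto
        have ab: "a \<in> carrier H" "b \<in> carrier H" using that Inr b y by auto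
        have "\<theta> v = \<psi> a \<otimes>\<^bsub>K\<^esub> (\<psi> b \<otimes>\<^bsub>K\<^esub> \<theta> v)" if "a \<otimes>\<^bsub>H\<^esub> b = \<one>\<^bsub>H\<^esub>"
          using that ab v by (metis K.l_one K.m_assoc q.hom_closed q.hom_mult q.hom_one)
        then show ?thesis using Inr b ab Cons v by (simp add: \<theta>C f_def K.m_assoc)
      qed
    next
      case False
      have w: "\<theta> w \<in> carrier K" using cl set_fp_words that(2) by blast
      then show ?thesis using False Cons that(1)
        by (cases x; cases y) (auto simp: \<theta>_def f_def)
    qed
  qed
  have mult: "\<theta> (foldr (fp_cons G H) u w) = \<theta> u \<otimes>\<^bsub>K\<^esub> \<theta> w"
    if "set u \<subseteq> syl" "w \<in> fp_words G H" for u w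
    using that(1)
  proof (induction u)
    case Nil
    then show ?case using cl set_fp_words that(2) by (simp add: \<theta>_def)
  next
    case (Cons x u)
    have "\<theta> w \<in> carrier K" "\<theta> u \<in> carrier K" "f x \<in> carrier K"
      using cl f set_fp_words that(2) Cons.prems by auto
    moreover have "\<theta> (x # u) = f x \<otimes>\<^bsub>K\<^esub> \<theta> u" by (simp add: \<theta>_def)
    ultimately show ?case
      using Cons cons foldr_closed that(2) by (simp add: K.m_assoc)
  qed
  have "\<theta> \<in> hom (free_product G H) K"
    using mult cl set_fp_words by (auto simp: hom_def)
  moreover have "\<theta> (fp_inl G H g) = \<phi> g" if "g \<in> carrier G" for g
    using cons[of "Inl g" "[]"] that by (simp add: fp_inl_def f_def \<theta>_def)
  moreover have "\<theta> (fp_inr G H h) = \<psi> h" if "h \<in> carrier H" for h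
    using cons[of "Inr h" "[]"] that by (simp add: fp_inr_def f_def \<theta>_def)
  ultimately show ?thesis by blast
qed

lemma free_product_universal_unique:
  assumes "group K" "\<theta> \<in> hom (free_product G H) K" "\<theta>' \<in> hom (free_product G H) K"
    "\<And>g. g \<in> carrier G \<Longrightarrow> \<theta> (fp_inl G H g) = \<theta>' (fp_inl G H g)"
    "\<And>h. h \<in> carrier H \<Longrightarrow> \<theta> (fp_inr G H h) = \<theta>' (fp_inr G H h)"
    "w \<in> carrier (free_product G H)"
  shows "\<theta> w = \<theta>' w"
proof -
  interpret K: group K by fact
  interpret P: group "free_product G H" by (rule group_free_product)
  interpret t: group_hom "free_product G H" K \<theta> by unfold_locales fact
  interpret t': group_hom "free_product G H" K \<theta>' by unfold_locales fact
  have "w \<in> fp_words G H" using assms(6) by simp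
  then show ?thesis
  proof (induction w)
    case Nil
    show ?case using t.hom_one t'.hom_one by simp
  next
    case (Cons x w)
    have x: "[x] \<in> carrier (free_product G H)" and w: "w \<in> carrier (free_product G H)"
      using Cons.prems by (auto simp: fp_words_Cons)
    have xw: "x # w = [x] \<otimes>\<^bsub>free_product G H\<^esub> w"
      using Cons.prems by (simp add: fp_cons_reduced)
    have "\<theta> [x] = \<theta>' [x]"
      proof (cases x)
      case (Inl g)
      then show ?thesis using x assms(4)[of g] by (auto simp: fp_inl_def fp_words_Cons)
    next
      case (Inr h)
      then show ?thesis using x assms(5)[of h] by (auto simp: fp_inr_def fp_words_Cons)
    qed
    then show ?case
      using Cons.IH w unfolding xw t.hom_mult[OF x w] t'.hom_mult[OF x w] by simp
  qed
qed

end

end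

theory Submission
  imports Defs "HOL-Library.Sublist"
begin

text \<open>
  Call a subset of the group eventual if it contains every element above some \<open>m\<close>. Suppose that
  the positive cone is generated by a finite set \<open>S\<close>. Whenever \<open>x \<prec> y\<close>, the element \<open>y\<close> is
  reached from \<open>x\<close> by an increasing path of right multiplications by elements of \<open>S\<close>. So if only
  finitely many edges of this kind leave or enter \<open>A\<close>, then \<open>A\<close> or its complement is eventual: no
  path above all these edges crosses the boundary of \<open>A\<close>. This applies to the set \<open>A\<close> of the normal
  forms that begin in \<open>G\<close>, because right multiplication by \<open>s\<close> changes the type of the first letter
  of \<open>x\<close> only if \<open>x\<close> is cancelled completely. As \<open>g\<close> maps the complement of \<open>A\<close> into \<open>A\<close> for
  \<open>1 \<noteq> g \<in> G\<close>, the set \<open>A\<close> itself is eventual. The same holds for the set of the normal forms that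
  begin in \<open>H\<close>, but two eventual sets always meet.
\<close>

section \<open>Strict order and upper bounds in a left-preordered group\<close>

locale left_preordered_group = group \<Gamma> for \<Gamma> (structure) +
  fixes R
  assumes left_preorder: "left_preorder \<Gamma> R"
begin

text \<open>\<open>R\<close> need not be antisymmetric, so strictness has to exclude equivalent
  elements, not only equal ones.\<close>

definition less (infix "\<prec>" 50) where
  "x \<prec> y \<longleftrightarrow> (x, y) \<in> R \<and> (y, x) \<notin> R"

definition eventual where
  "eventual A \<longleftrightarrow> (\<exists>m\<in>carrier \<Gamma>. \<forall>x\<in>carrier \<Gamma>. m \<prec> x \<longrightarrow> x \<in> A)"

lemma
  shows le_refl: "x \<in> carrier \<Gamma> \<Longrightarrow> (x, x) \<in> R"
    and le_trans: "(x, y) \<in> R \<Longrightarrow> (y, z) \<in> R \<Longrightarrow> (x, z) \<in> R"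
    and le_closed: "(x, y) \<in> R \<Longrightarrow> x \<in> carrier \<Gamma> \<and> y \<in> carrier \<Gamma>"
    and le_mult: "g \<in> carrier \<Gamma> \<Longrightarrow> (x, y) \<in> R \<Longrightarrow> (g \<otimes> x, g \<otimes> y) \<in> R"
  using left_preorder
  unfolding left_preorder_def preorder_on_def refl_on_def trans_def by blast+

lemma le_total: "x \<in> carrier \<Gamma> \<Longrightarrow> y \<in> carrier \<Gamma> \<Longrightarrow> (x, y) \<in> R \<or> (y, x) \<in> R"
  using left_preorder le_refl
  unfolding left_preorder_def total_on_def by metis

lemma le_mult_iff:
  assumes "g \<in> carrier \<Gamma>" "x \<in> carrier \<Gamma>" "y \<in> carrier \<Gamma>"
  shows "(g \<otimes> x, g \<otimes> y) \<in> R \<longleftrightarrow> (x, y) \<in> R"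
proof
  assume "(g \<otimes> x, g \<otimes> y) \<in> R"
  from le_mult[OF inv_closed[OF assms(1)] this] show "(x, y) \<in> R"
    using assms by (simp flip: m_assoc)
qed (use assms le_mult in blast)

lemma less_mult_iff:
  "g \<in> carrier \<Gamma> \<Longrightarrow> x \<in> carrier \<Gamma> \<Longrightarrow> y \<in> carrier \<Gamma> \<Longrightarrow> g \<otimes> x \<prec> g \<otimes> y \<longleftrightarrow> x \<prec> y"
  by (simp add: less_def le_mult_iff)

lemma le_less_trans: "(x, y) \<in> R \<Longrightarrow> y \<prec> z \<Longrightarrow> x \<prec> z"
  unfolding less_def using le_trans by blast

lemma less_mult_right:
  assumes "x \<in> carrier \<Gamma>" "p \<in> carrier \<Gamma>" "\<one> \<prec> p"
  shows "x \<prec> x \<otimes> p"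
  using less_mult_iff[of x \<one> p] assms by simp

lemma positive_cone_eq: "positive_cone \<Gamma> R = {p \<in> carrier \<Gamma>. \<one> \<prec> p}"
  by (auto simp: positive_cone_def preorder_residue_def less_def)

text \<open>Non-triviality gives a pair with \<open>(x, y) \<notin> R\<close>, totality turns it
  into \<open>y \<prec> x\<close>, and left translation by \<open>inv y\<close> moves
  \<open>y\<close> to the identity.\<close>

lemma positive_cone_nonempty: "\<exists>p\<in>carrier \<Gamma>. \<one> \<prec> p"
proof -
  obtain x y where xy: "x \<in> carrier \<Gamma>" "y \<in> carrier \<Gamma>" "(x, y) \<notin> R"
    using left_preorder le_closed unfolding left_preorder_def by fast
  then have "y \<prec> x" using le_total by (auto simp: less_def)
  then have "inv y \<otimes> y \<prec> inv y \<otimes> x" using xy less_mult_iff[of "inv y" y x] by simp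
  then show ?thesis using xy by auto
qed

lemma finite_upper_bound:
  assumes "finite B" "B \<subseteq> carrier \<Gamma>"
  shows "\<exists>m\<in>carrier \<Gamma>. \<forall>b\<in>B. (b, m) \<in> R"
  using assms
proof (induction B)
  case (insert b B)
  then obtain m where m: "m \<in> carrier \<Gamma>" "\<forall>b\<in>B. (b, m) \<in> R" by auto
  show ?case
  proof (cases "(b, m) \<in> R")
    case False
    then have "(m, b) \<in> R" using le_total m insert.prems by auto
    then show ?thesis using m insert.prems le_trans le_refl by (intro bexI[of _ b]) auto
  qed (use m in auto)
qed auto

section \<open>Eventual sets\<close>

text \<open>There is no maximum: a common upper bound \<open>k\<close> of both thresholds is
  strictly exceeded by \<open>k \<otimes> p\<close> with \<open>p\<close> positive.\<close>

lemma eventual_meet: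
  assumes "eventual A" "eventual B"
  shows "A \<inter> B \<noteq> {}"
proof -
  obtain m n where m: "m \<in> carrier \<Gamma>" "\<And>x. x \<in> carrier \<Gamma> \<Longrightarrow> m \<prec> x \<Longrightarrow> x \<in> A"
    and n: "n \<in> carrier \<Gamma>" "\<And>x. x \<in> carrier \<Gamma> \<Longrightarrow> n \<prec> x \<Longrightarrow> x \<in> B"
    using assms unfolding eventual_def by blast
  obtain k where k: "k \<in> carrier \<Gamma>" "(m, k) \<in> R" "(n, k) \<in> R"
    using finite_upper_bound[of "{m, n}"] m n by auto
  obtain p where p: "p \<in> carrier \<Gamma>" "\<one> \<prec> p" using positive_cone_nonempty by blast
  then have "k \<prec> k \<otimes> p" using k less_mult_right by simp
  then show ?thesis using m n k p le_less_trans by (meson disjoint_iff m_closed)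
qed

text \<open>Left translation preserves \<open>\<prec>\<close>, so a threshold \<open>m\<close> for
  \<open>A\<close> gives the threshold \<open>t \<otimes> m\<close> for \<open>B\<close>.\<close>

lemma eventual_translate:
  assumes "t \<in> carrier \<Gamma>" "eventual A"
    and "\<And>x. x \<in> carrier \<Gamma> \<Longrightarrow> x \<in> A \<Longrightarrow> t \<otimes> x \<in> B"
  shows "eventual B"
proof -
  obtain m where m: "m \<in> carrier \<Gamma>" "\<And>x. x \<in> carrier \<Gamma> \<Longrightarrow> m \<prec> x \<Longrightarrow> x \<in> A"
    using assms(2) unfolding eventual_def by blast
  have "x \<in> B" if x: "x \<in> carrier \<Gamma>" "t \<otimes> m \<prec> x" for x
  proof -
    have eq: "t \<otimes> (inv t \<otimes> x) = x" using x assms(1) by (simp flip: m_assoc)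
    have "m \<prec> inv t \<otimes> x"
      using less_mult_iff[of t m "inv t \<otimes> x"] x m assms(1) unfolding eq by simp
    then show ?thesis using assms(3)[of "inv t \<otimes> x"] m x assms(1) unfolding eq by simp
  qed
  then show ?thesis using m assms(1) unfolding eventual_def by blast
qed

section \<open>Increasing paths and sets with finite boundary\<close>

text \<open>Writing \<open>p\<close> as a product of generators gives an increasing path from
  \<open>x\<close> to \<open>x \<otimes> p\<close>, and some edge of it crosses the boundary of
  \<open>A\<close>. The bound \<open>(x, z) \<in> R\<close> is what later contradicts an upper bound
  on all such edges.\<close>

lemma crossing:
  assumes "p \<in> subsemigroup_generated \<Gamma> S" "\<And>s. s \<in> S \<Longrightarrow> s \<in> carrier \<Gamma> \<and> \<one> \<prec> s"
    and "x \<in> carrier \<Gamma>" "(x \<in> A) \<noteq> (x \<otimes> p \<in> A)"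
  shows "\<exists>z\<in>carrier \<Gamma>. \<exists>s\<in>S. (x, z) \<in> R \<and> (z \<in> A) \<noteq> (z \<otimes> s \<in> A)"
proof -
  have pos: "q \<in> carrier \<Gamma> \<and> \<one> \<prec> q" if "q \<in> subsemigroup_generated \<Gamma> S" for q
    using that
  proof induction
    case (mult a b)
    then show ?case using less_mult_right[of a b] le_less_trans less_def by blast
  qed (use assms(2) in blast)
  show ?thesis
    using assms(1,3,4)
  proof (induction arbitrary: x)
    case (incl s)
    then show ?case using le_refl by blast
  next
    case (mult a b)
    have ab: "a \<in> carrier \<Gamma>" "b \<in> carrier \<Gamma>" "\<one> \<prec> a" using mult.hyps pos by auto
    show ?case
    proof (cases "(x \<in> A) = (x \<otimes> a \<in> A)")
      case True
      then have "(x \<otimes> a \<in> A) \<noteq> (x \<otimes> a \<otimes> b \<in> A)" using mult.prems ab by (simp add: m_assoc)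
      then obtain z s where "z \<in> carrier \<Gamma>" "s \<in> S" "(x \<otimes> a, z) \<in> R" "(z \<in> A) \<noteq> (z \<otimes> s \<in> A)"
        using mult.IH(2)[of "x \<otimes> a"] mult.prems ab by auto
      moreover have "(x, x \<otimes> a) \<in> R" using less_mult_right mult.prems ab less_def by blast
      ultimately show ?thesis using le_trans by blast
    qed (use mult in blast)
  qed
qed

lemma eventual_or_compl:
  assumes S: "finite S" "positive_cone \<Gamma> R = subsemigroup_generated \<Gamma> S"
    and bd: "\<And>s. s \<in> carrier \<Gamma> \<Longrightarrow> finite {x \<in> carrier \<Gamma>. (x \<in> A) \<noteq> (x \<otimes> s \<in> A)}"
  shows "eventual A \<or> eventual (- A)"
proof -
  have pos: "s \<in> carrier \<Gamma> \<and> \<one> \<prec> s" if "s \<in> S" for s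
    using subsemigroup_generated.incl[OF that, of \<Gamma>] unfolding S(2)[symmetric] positive_cone_eq
    by simp
  \<comment> \<open>The starting points of the boundary edges suffice, since \<open>crossing\<close>
    bounds the start of an edge from below.\<close>
  define B where "B = (\<Union>s\<in>S. {x \<in> carrier \<Gamma>. (x \<in> A) \<noteq> (x \<otimes> s \<in> A)})"
  have "finite B" unfolding B_def using S(1) bd pos by blast
  moreover have "B \<subseteq> carrier \<Gamma>" unfolding B_def by blast
  ultimately obtain m where m: "m \<in> carrier \<Gamma>" "\<And>b. b \<in> B \<Longrightarrow> (b, m) \<in> R"
    using finite_upper_bound[of B] by auto
  have step: "(x \<in> A) = (y \<in> A)"
    if "x \<in> carrier \<Gamma>" "y \<in> carrier \<Gamma>" "m \<prec> x" "x \<prec> y" for x y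
  proof (rule ccontr)
    assume A: "\<not> ?thesis"
    have eq: "x \<otimes> (inv x \<otimes> y) = y" using that by (simp flip: m_assoc)
    have "inv x \<otimes> x \<prec> inv x \<otimes> y" using that less_mult_iff[of "inv x" x y] by simp
    then have "inv x \<otimes> y \<in> subsemigroup_generated \<Gamma> S"
      using that unfolding S(2)[symmetric] positive_cone_eq by simp
    from crossing[OF this pos that(1), of A] obtain z where "z \<in> B" "(x, z) \<in> R"
      using A unfolding eq B_def by blast
    then show False using m that(3) le_trans less_def by blast
  qed
  obtain p where p: "p \<in> carrier \<Gamma>" "\<one> \<prec> p" using positive_cone_nonempty by blast
  have "(x \<in> A) = (y \<in> A)"
    if x: "x \<in> carrier \<Gamma>" "m \<prec> x" and y: "y \<in> carrier \<Gamma>" "m \<prec> y" for x y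
  proof -
    \<comment> \<open>\<open>x\<close> and \<open>y\<close> may be equivalent, while
      \<open>step\<close> needs strict inequalities; so both are compared with
      \<open>k \<otimes> p\<close>, which lies strictly above each.\<close>
    obtain k where k: "k \<in> carrier \<Gamma>" "(x, k) \<in> R" "(y, k) \<in> R"
      using finite_upper_bound[of "{x, y}"] x y by auto
    then have "k \<prec> k \<otimes> p" using p less_mult_right by simp
    then have "x \<prec> k \<otimes> p" "y \<prec> k \<otimes> p" using k le_less_trans by blast+
    then show ?thesis using step x y k p by (metis m_closed)
  qed
  then show ?thesis using m(1) unfolding eventual_def by blast
qed

text \<open>This isolates what is needed of the free product: two disjoint sets with finite
  boundary, each containing a left translate of its complement.\<close>

lemma not_finitely_generated:
  assumes "A \<inter> B = {}"
    and bdA: "\<And>s. s \<in> carrier \<Gamma> \<Longrightarrow> finite {x \<in> carrier \<Gamma>. (x \<in> A) \<noteq> (x \<otimes> s \<in> A)}"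
    and bdB: "\<And>s. s \<in> carrier \<Gamma> \<Longrightarrow> finite {x \<in> carrier \<Gamma>. (x \<in> B) \<noteq> (x \<otimes> s \<in> B)}"
    and A: "t \<in> carrier \<Gamma>" "\<And>x. x \<in> carrier \<Gamma> \<Longrightarrow> x \<notin> A \<Longrightarrow> t \<otimes> x \<in> A"
    and B: "u \<in> carrier \<Gamma>" "\<And>x. x \<in> carrier \<Gamma> \<Longrightarrow> x \<notin> B \<Longrightarrow> u \<otimes> x \<in> B"
  shows "\<not> finitely_generated_subsemigroup \<Gamma> (positive_cone \<Gamma> R)"
proof
  assume "finitely_generated_subsemigroup \<Gamma> (positive_cone \<Gamma> R)"
  then obtain S where S: "finite S" "positive_cone \<Gamma> R = subsemigroup_generated \<Gamma> S"
    unfolding finitely_generated_subsemigroup_def by blast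
  have "eventual A"
    using eventual_or_compl[OF S bdA] eventual_translate[OF A(1), of "- A" A] A(2) by blast
  moreover have "eventual B"
    using eventual_or_compl[OF S bdB] eventual_translate[OF B(1), of "- B" B] B(2) by blast
  ultimately show False using eventual_meet assms(1) by blast
qed

end

section \<open>Cancellation in products of normal forms\<close>

lemma fp_cons_hd:
  "isl (hd (fp_cons G H x (y # w))) = isl x \<and> fp_cons G H x (y # w) \<noteq> [] \<or>
   fp_cons G H x (y # w) = w \<or> fp_cons G H x (y # w) = y # w"
  by (cases x; cases y) auto

text \<open>As long as \<open>u\<close> only cancels, a suffix of \<open>v\<close> remains. Once a
  letter of \<open>u\<close> survives, alone or merged, each further letter comes from the other
  factor and is simply prepended.\<close>

lemma foldr_fp_cons_suffix_or_hd:
  assumes "u \<in> fp_words G H"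
  shows "suffix (foldr (fp_cons G H) u v) v \<or>
    u \<noteq> [] \<and> foldr (fp_cons G H) u v \<noteq> [] \<and> isl (hd (foldr (fp_cons G H) u v)) = isl (hd u)"
  using assms
proof (induction u)
  case (Cons a u)
  define w where "w = foldr (fp_cons G H) u v"
  have a: "a \<in> fp_letters G H" and u: "u \<in> fp_words G H" "u \<noteq> [] \<longrightarrow> isl (hd u) \<noteq> isl a"
    using Cons.prems by (auto simp: fp_words_Cons)
  consider (suf) "suffix w v" | (hd) "u \<noteq> []" "w \<noteq> []" "isl (hd w) = isl (hd u)"
    using Cons.IH u unfolding w_def by blast
  then have "suffix (fp_cons G H a w) v \<or>
    fp_cons G H a w \<noteq> [] \<and> isl (hd (fp_cons G H a w)) = isl a"
  proof cases
    case suf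
    show ?thesis
    proof (cases w)
      case Nil
      then show ?thesis using a by (cases a) auto
    next
      case (Cons b w')
      then have "suffix w' v" using suf by (metis suffix_ConsD)
      then show ?thesis using fp_cons_hd[of G H a b w'] suf Cons by auto
    qed
  next
    case hd
    \<comment> \<open>The word \<open>a # u\<close> is reduced, so \<open>a\<close> and the first
      letter of \<open>w\<close> lie in different factors and nothing cancels.\<close>
    then have "isl (hd w) \<noteq> isl a" using u by simp
    then show ?thesis using hd a by (cases a; cases w; cases "hd w") auto
  qed
  then show ?case by (simp add: w_def)
qed simp

context two_groups
begin

text \<open>If membership in \<open>A\<close> changes, the product of \<open>x\<close> and
  \<open>s\<close> is a suffix of \<open>s\<close>. There are finitely many suffixes, and each
  determines \<open>x\<close> by right cancellation.\<close>

lemma finite_boundary: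
  fixes b :: bool
  defines "A \<equiv> {w. w \<noteq> [] \<and> isl (hd w) = b}"
  assumes "s \<in> fp_words G H"
  shows "finite {x \<in> fp_words G H. (x \<in> A) \<noteq> (foldr (fp_cons G H) x s \<in> A)}"
proof -
  interpret P: group "free_product G H" by (rule group_free_product)
  have inj: "inj_on (\<lambda>x. foldr (fp_cons G H) x s) (fp_words G H)"
  proof (rule inj_onI)
    fix x y
    assume "x \<in> fp_words G H" "y \<in> fp_words G H"
      "foldr (fp_cons G H) x s = foldr (fp_cons G H) y s"
    then show "x = y" using P.right_cancel[of s x y] assms(2) by simp
  qed
  have "finite {w. suffix w s}"
    using finite_set[of "suffixes s"] by (simp only: set_suffixes_eq)
  from finite_vimage_IntI[OF this inj] show ?thesis
  proof (rule rev_finite_subset, intro subsetI)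
    fix x
    assume "x \<in> {x \<in> fp_words G H. (x \<in> A) \<noteq> (foldr (fp_cons G H) x s \<in> A)}"
    then show "x \<in> (\<lambda>x. foldr (fp_cons G H) x s) -` {w. suffix w s} \<inter> fp_words G H"
      using foldr_fp_cons_suffix_or_hd[of x G H s] by (auto simp: A_def)
  qed
qed

lemma positive_cone_not_finitely_generated:
  assumes "carrier G \<noteq> {\<one>\<^bsub>G\<^esub>}" "carrier H \<noteq> {\<one>\<^bsub>H\<^esub>}"
    and "left_preorder (free_product G H) R"
  shows "\<not> finitely_generated_subsemigroup (free_product G H) (positive_cone (free_product G H) R)"
proof -
  interpret P: group "free_product G H" by (rule group_free_product)
  interpret P: left_preordered_group "free_product G H" R by unfold_locales fact
  obtain g h where gh: "Inl g \<in> fp_letters G H" "Inr h \<in> fp_letters G H"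
    using assms(1,2) G.one_closed H.one_closed by auto
  \<comment> \<open>A normal form that is empty or begins in \<open>H\<close> does not interact with
    \<open>g\<close>, so left multiplication by \<open>g\<close> makes it begin in
    \<open>G\<close>.\<close>
  have g: "fp_cons G H (Inl g) x = Inl g # x" if "\<not> (x \<noteq> [] \<and> isl (hd x) = True)" for x
    using that gh by (cases x; cases "hd x") auto
  have h: "fp_cons G H (Inr h) x = Inr h # x" if "\<not> (x \<noteq> [] \<and> isl (hd x) = False)" for x
    using that gh by (cases x; cases "hd x") auto
  show ?thesis
  proof (rule P.not_finitely_generated)
    show "{w. w \<noteq> [] \<and> isl (hd w) = True} \<inter> {w. w \<noteq> [] \<and> isl (hd w) = False} = {}" by auto
    show "[Inl g] \<in> carrier (free_product G H)" "[Inr h] \<in> carrier (free_product G H)"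
      using gh by (simp_all add: fp_words_Cons)
  qed (use finite_boundary[of _ True] finite_boundary[of _ False] g h in simp_all)
qed

end

theorem corollary4p12:
  fixes G :: "('a, 'c) monoid_scheme" and H :: "('b, 'd) monoid_scheme"
    and C :: "('a + 'b) list set" and R :: "(('a + 'b) list \<times> ('a + 'b) list) set"
  assumes "group G" and "carrier G \<noteq> {\<one>\<^bsub>G\<^esub>}"
    and "group H" and "carrier H \<noteq> {\<one>\<^bsub>H\<^esub>}"
    and "left_relatively_convex (free_product G H) C"
    and "kurosh_rank G H C < \<infinity>"
    and "left_preorder_relative (free_product G H) C R"
  shows "\<not> finitely_generated_subsemigroup (free_product G H) (positive_cone (free_product G H) R)"
proof -
  interpret two_groups G H by (intro two_groups.intro assms)
  show ?thesis
    using positive_cone_not_finitely_generated assms unfolding left_preorder_relative_def by blast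
qed

end
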